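(* Two right-ideal morphisms $f,g:A^*\to A^*$ have the same action on $A^{\omega}$ if and only if $g\equiv_{\sf bd}f$. Hence on $A^{\omega}$, for all right-ideal morphisms $f,g$: $g_{\sf b,max}\circ f_{\sf b,max}=(g\circ f)_{\sf b,max}$. The relation $\equiv_{\sf bd}$ is a congruence on the monoid of all right-ideal morphisms of $A^*$, and in particular on ${\cal RM}^{\sf P}$.
   Context: Let $A=\{0,1\}$, $A^*$ the set of all finite words over $A$ (including the empty word), $|x|$ the length of $x$, and $A^{\omega}$ the set of all $\omega$-sequences over $A$. "Function" means partial function; ${\sf Dom}(f)$ is the domain of $f$. For words $v,w$: $v \parallel_{\sf pref} w$ means that one of $v,w$ is a prefix of the other. A prefix code is a set $P\subset A^*$ in which no two distinct elements are prefix-comparable. A right ideal is a set $R\subseteq A^*$ with $RA^*=R$; every right ideal $R$ equals $PA^*$ for a unique prefix code $P$. A right-ideal morphism is a partial function $h:A^*\to A^*$ such that ${\sf Dom}(h)$ is a right ideal and $h(xw)=h(x)\,w$ for all $x\in{\sf Dom}(h)$, $w\in A^*$. ${\sf domC}(h)$ is the prefix code that generates ${\sf Dom}(h)$ as a right ideal. Action on $A^{\omega}$: a right-ideal morphism $f$ acts as the partial function on $A^{\omega}$ with domain ${\sf domC}(f)\,A^{\omega}$ given by $f(pw)=f(p)\,w$ for $p\in{\sf domC}(f)$, $w\in A^{\omega}$. For $L_1,L_2\subseteq A^*$: $L_1\equiv_{\sf end}L_2$ iff $L_1A^*$ and $L_2A^*$ intersect (i.e., meet in a nonempty set) the same right ideals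 of $A^*$. For prefix codes $P_1,P_2$: $P_1\equiv_{\sf bd}P_2$ iff $P_1\equiv_{\sf end}P_2$ and there is a total function $\beta:{\mathbb N}\to{\mathbb N}$ (no computability assumed) such that for all $x_1\in P_1$, $x_2\in P_2$ with $x_1\parallel_{\sf pref}x_2$: $|x_1|\le\beta(|x_2|)$ and $|x_2|\le\beta(|x_1|)$. For right-ideal morphisms: $f\equiv_{\sf bd}g$ iff ${\sf domC}(f)\equiv_{\sf bd}{\sf domC}(g)$ and $f,g$ agree on ${\sf Dom}(f)\cap{\sf Dom}(g)$. For a right-ideal morphism $f$, $f_{\sf b,max}=\bigcup\{g : g \text{ is a right-ideal morphism with } g\equiv_{\sf bd}f\}$ (union of graphs), which is itself a right-ideal morphism. ${\cal RM}^{\sf P}$ is the monoid (under composition) of all right-ideal morphisms $f$ of $A^*$ that are computable by deterministic Turing machines in polynomial time and are polynomially balanced (there is a polynomial $p$ with $|f(x)|\le p(|x|)$ and $|x|\le p(|f(x)|)$ for all $x\in{\sf Dom}(f)$). *)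

theory Defs
  imports
    "HOL-Library.Sublist"
    "HOL-Library.Stream"
    "HOL-Computational_Algebra.Polynomial"
begin

section \<open>Words, right ideals and prefix codes\<close>

text \<open>The alphabet \<open>{0,1}\<close> is \<^typ>\<open>bool\<close>; \<open>\<omega>\<close>-sequences are \<^typ>\<open>bool stream\<close>.\<close>

type_synonym word = "bool list"

text \<open>Not to be confused with \<open>parallel\<close> of \<open>Sublist\<close>, which means the opposite.\<close>

definition pref_comparable :: "word \<Rightarrow> word \<Rightarrow> bool" where
  "pref_comparable v w \<longleftrightarrow> prefix v w \<or> prefix w v"

definition prefix_code :: "word set \<Rightarrow> bool" where
  "prefix_code P \<longleftrightarrow> (\<forall>x\<in>P. \<forall>y\<in>P. x \<noteq> y \<longrightarrow> \<not> pref_comparable x y)"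

text \<open>\<open>right_span L\<close> is \<open>L A\<^sup>*\<close>.\<close>

definition right_span :: "word set \<Rightarrow> word set" where
  "right_span L = {x @ w | x w. x \<in> L}"

definition right_ideal :: "word set \<Rightarrow> bool" where
  "right_ideal R \<longleftrightarrow> right_span R = R"

section \<open>Right-ideal morphisms\<close>

definition right_ideal_morphism :: "(word \<rightharpoonup> word) \<Rightarrow> bool" where
  "right_ideal_morphism h \<longleftrightarrow>
     right_ideal (dom h) \<and> (\<forall>x\<in>dom h. \<forall>w. h (x @ w) = Some (the (h x) @ w))"

definition RM :: "(word \<rightharpoonup> word) set" where
  "RM = {h. right_ideal_morphism h}"

definition domC :: "(word \<rightharpoonup> word) \<Rightarrow> word set" where
  "domC h = (THE P. prefix_code P \<and> right_span P = dom h)"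

text \<open>The definite description is justified by \<open>omega_action_shift\<close> below:
  at most one element of \<open>domC f\<close> is a prefix of a given sequence.\<close>

definition omega_action :: "(word \<rightharpoonup> word) \<Rightarrow> (bool stream \<rightharpoonup> bool stream)" where
  "omega_action f s =
     (if \<exists>p\<in>domC f. \<exists>w. s = p @- w
      then Some (THE t. \<exists>p\<in>domC f. \<exists>w. s = p @- w \<and> t = the (f p) @- w)
      else None)"

section \<open>The equivalences\<close>

definition end_equiv :: "word set \<Rightarrow> word set \<Rightarrow> bool" where
  "end_equiv L1 L2 \<longleftrightarrow>
     (\<forall>R. right_ideal R \<longrightarrow> (right_span L1 \<inter> R \<noteq> {} \<longleftrightarrow> right_span L2 \<inter> R \<noteq> {}))"

definition bd_equiv_code :: "word set \<Rightarrow> word set \<Rightarrow> bool" where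
  "bd_equiv_code P1 P2 \<longleftrightarrow> end_equiv P1 P2 \<and>
     (\<exists>\<beta> :: nat \<Rightarrow> nat. \<forall>x1\<in>P1. \<forall>x2\<in>P2. pref_comparable x1 x2 \<longrightarrow>
        length x1 \<le> \<beta> (length x2) \<and> length x2 \<le> \<beta> (length x1))"

definition bd_equiv :: "(word \<rightharpoonup> word) \<Rightarrow> (word \<rightharpoonup> word) \<Rightarrow> bool" where
  "bd_equiv f g \<longleftrightarrow> bd_equiv_code (domC f) (domC g) \<and> (\<forall>x\<in>dom f \<inter> dom g. f x = g x)"

text \<open>The map whose graph is the union of the graphs of all right-ideal morphisms \<open>g\<close> with
  \<open>bd_equiv g f\<close>; this union is single-valued, see \<open>graph_bmax\<close> below.\<close>

definition bmax :: "(word \<rightharpoonup> word) \<Rightarrow> (word \<rightharpoonup> word)" where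
  "bmax f x =
     (let G = \<Union>{Map.graph g | g. right_ideal_morphism g \<and> bd_equiv g f}
      in if \<exists>y. (x, y) \<in> G then Some (THE y. (x, y) \<in> G) else None)"

text \<open>\<open>M\<close> is meant to be closed under \<open>mul\<close>; only the restriction of \<open>R\<close> to \<open>M\<close> matters.\<close>

definition congruence_on :: "'a set \<Rightarrow> ('a \<Rightarrow> 'a \<Rightarrow> 'a) \<Rightarrow> ('a \<Rightarrow> 'a \<Rightarrow> bool) \<Rightarrow> bool" where
  "congruence_on M mul R \<longleftrightarrow>
     equiv M {(a, b). a \<in> M \<and> b \<in> M \<and> R a b} \<and>
     (\<forall>a\<in>M. \<forall>b\<in>M. \<forall>c\<in>M. \<forall>d\<in>M. R a b \<and> R c d \<longrightarrow> R (mul a c) (mul b d))"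

section \<open>Polynomial-time Turing machines\<close>

text \<open>Deterministic machines with one two-way infinite tape. The transition function is only
  relevant on \<^term>\<open>states\<close> other than the two halting states and on \<^term>\<open>symbols\<close>.\<close>

datatype tape_symbol = Blank | Bit bool | Aux nat

datatype head_move = Move_Left | Move_Right | Stay

record turing_machine =
  states :: "nat set"
  symbols :: "tape_symbol set"
  start :: nat
  accepting :: nat
  rejecting :: nat
  transition :: "nat \<Rightarrow> tape_symbol \<Rightarrow> nat \<times> tape_symbol \<times> head_move"

definition wf_tm :: "turing_machine \<Rightarrow> bool" where
  "wf_tm M \<longleftrightarrow>
     finite (states M) \<and> finite (symbols M) \<and> Blank \<in> symbols M \<and> range Bit \<subseteq> symbols M \<and>
     start M \<in> states M \<and> accepting M \<in> states M \<and> rejecting M \<in> states M \<and>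
     accepting M \<noteq> rejecting M \<and>
     (\<forall>q\<in>states M - {accepting M, rejecting M}. \<forall>a\<in>symbols M.
        case transition M q a of (q', b, _) \<Rightarrow> q' \<in> states M \<and> b \<in> symbols M)"

text \<open>A configuration consists of state, tape and head position.\<close>

type_synonym tm_config = "nat \<times> (int \<Rightarrow> tape_symbol) \<times> int"

fun head_shift :: "head_move \<Rightarrow> int" where
  "head_shift Move_Left = -1"
| "head_shift Move_Right = 1"
| "head_shift Stay = 0"

definition initial_config :: "turing_machine \<Rightarrow> word \<Rightarrow> tm_config" where
  "initial_config M x =
     (start M, \<lambda>i. if 0 \<le> i \<and> i < int (length x) then Bit (x ! nat i) else Blank, 0)"

fun tm_step :: "turing_machine \<Rightarrow> tm_config \<Rightarrow> tm_config" where
  "tm_step M (q, tape, i) =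
     (if q \<in> {accepting M, rejecting M} then (q, tape, i)
      else case transition M q (tape i) of (q', b, m) \<Rightarrow> (q', tape(i := b), i + head_shift m))"

fun accepts_with :: "turing_machine \<Rightarrow> tm_config \<Rightarrow> word \<Rightarrow> bool" where
  "accepts_with M (q, tape, i) y \<longleftrightarrow> q = accepting M \<and>
     (\<forall>k<length y. tape (i + int k) = Bit (y ! k)) \<and> tape (i + int (length y)) = Blank"

fun rejects :: "turing_machine \<Rightarrow> tm_config \<Rightarrow> bool" where
  "rejects M (q, tape, i) \<longleftrightarrow> q = rejecting M"

text \<open>On every input the machine halts within the time bound; it accepts exactly the inputs in
  the domain of \<open>f\<close>, leaving the value written from the head position onwards.\<close>

definition poly_time_computable :: "(word \<rightharpoonup> word) \<Rightarrow> bool" where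
  "poly_time_computable f \<longleftrightarrow>
     (\<exists>M (p :: nat poly). wf_tm M \<and>
        (\<forall>x. \<exists>t \<le> poly p (length x).
           case f x of
             Some y \<Rightarrow> accepts_with M ((tm_step M ^^ t) (initial_config M x)) y
           | None \<Rightarrow> rejects M ((tm_step M ^^ t) (initial_config M x))))"

definition poly_balanced :: "(word \<rightharpoonup> word) \<Rightarrow> bool" where
  "poly_balanced f \<longleftrightarrow>
     (\<exists>p :: nat poly. \<forall>x\<in>dom f.
        length (the (f x)) \<le> poly p (length x) \<and> length x \<le> poly p (length (the (f x))))"

definition RMP :: "(word \<rightharpoonup> word) set" where
  "RMP = {f. right_ideal_morphism f \<and> poly_time_computable f \<and> poly_balanced f}"

section \<open>Well-definedness\<close>

lemma right_ideal_append: "right_ideal R \<Longrightarrow> x \<in> R \<Longrightarrow> x @ w \<in> R"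
  unfolding right_ideal_def right_span_def by blast

lemma right_spanI: "x \<in> L \<Longrightarrow> x \<in> right_span L"
  unfolding right_span_def by (metis (mono_tags, lifting) CollectI append_Nil2)

lemma right_idealI:
  assumes "\<And>x w. x \<in> R \<Longrightarrow> x @ w \<in> R"
  shows "right_ideal R"
proof -
  have "right_span R \<subseteq> R" unfolding right_span_def using assms by blast
  then show ?thesis unfolding right_ideal_def using right_spanI by blast
qed

lemma right_ideal_right_span: "right_ideal (right_span L)"
proof (rule right_idealI)
  fix x w assume "x \<in> right_span L"
  then obtain y v where "x = y @ v" "y \<in> L" by (auto simp: right_span_def)
  then have "x @ w = y @ (v @ w)" "y \<in> L" by auto
  then show "x @ w \<in> right_span L" unfolding right_span_def by blast
qed

lemma prefix_code_span_mono:
  assumes "prefix_code P" "prefix_code Q" "right_span P = right_span Q"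
  shows "P \<subseteq> Q"
proof
  fix p assume p: "p \<in> P"
  then have "p \<in> right_span Q"
    using assms(3) right_spanI by auto
  then obtain q w where q: "q \<in> Q" "p = q @ w" by (auto simp: right_span_def)
  then have "q \<in> right_span P"
    using assms(3) right_spanI by auto
  then obtain p' w' where p': "p' \<in> P" "q = p' @ w'" by (auto simp: right_span_def)
  then have "pref_comparable p p'" using q by (auto simp: pref_comparable_def)
  then have "p = p'" using assms(1) p p' by (auto simp: prefix_code_def)
  then show "p \<in> Q" using q p' by auto
qed

lemma ex1_prefix_code:
  assumes "right_ideal R"
  shows "\<exists>!P. prefix_code P \<and> right_span P = R"
proof (rule ex_ex1I)
  let ?P = "{x \<in> R. \<forall>y\<in>R. prefix y x \<longrightarrow> y = x}"
  have "x \<in> right_span ?P" if "x \<in> R" for x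
    using that
  proof (induction x rule: measure_induct_rule[of length])
    case (less x)
    show ?case
    proof (cases "x \<in> ?P")
      case True
      then show ?thesis by (rule right_spanI)
    next
      case False
      then obtain y where y: "y \<in> R" "prefix y x" "y \<noteq> x" using less.prems by auto
      then have "length y < length x"
        by (simp add: prefix_length_less prefix_order.order_iff_strict)
      then have "y \<in> right_span ?P" using less.IH y by blast
      then have "y @ w \<in> right_span ?P" for w
        by (rule right_ideal_append[OF right_ideal_right_span])
      then show ?thesis using y(2) by (elim prefixE) (simp only:)
    qed
  qed
  moreover have "right_span ?P \<subseteq> R"
    using right_ideal_append[OF assms] by (auto simp: right_span_def)
  moreover have "prefix_code ?P" by (auto simp: prefix_code_def pref_comparable_def)
  ultimately show "\<exists>P. prefix_code P \<and> right_span P = R" by blast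
next
  fix P Q assume "prefix_code P \<and> right_span P = R" "prefix_code Q \<and> right_span Q = R"
  then show "P = Q" using prefix_code_span_mono by (metis subset_antisym)
qed

lemma domC:
  assumes "right_ideal_morphism f"
  shows "prefix_code (domC f)" "right_span (domC f) = dom f"
  using theI'[OF ex1_prefix_code[of "dom f"]] assms
  unfolding domC_def right_ideal_morphism_def by blast+

lemma shift_eq_prefix:
  assumes "p @- v = q @- w" "length p \<le> length q"
  shows "prefix p q"
proof -
  have "p = stake (length p) (p @- v)" by (simp add: stake_shift)
  also have "\<dots> = stake (length p) (q @- w)" by (simp only: assms(1))
  also have "\<dots> = take (length p) q" using assms(2) by (simp add: stake_shift)
  finally show ?thesis using take_is_prefix[of "length p" q] by simp
qed

lemma shift_eq_comparable:
  assumes "p @- v = q @- w"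
  shows "pref_comparable p q"
proof (cases "length p \<le> length q")
  case True
  then show ?thesis using shift_eq_prefix[OF assms] by (simp add: pref_comparable_def)
next
  case False
  then show ?thesis using shift_eq_prefix[OF assms[symmetric]] by (simp add: pref_comparable_def)
qed

lemma omega_action_shift:
  assumes "right_ideal_morphism f" "p \<in> domC f"
  shows "omega_action f (p @- w) = Some (the (f p) @- w)"
proof -
  have "q = p \<and> v = w" if "q \<in> domC f" "p @- w = q @- v" for q v
  proof -
    have "q = p"
      using shift_eq_comparable[OF that(2)] domC(1)[OF assms(1)] assms(2) that(1)
      by (auto simp: prefix_code_def)
    then show ?thesis using that(2) by auto
  qed
  then have "(THE t. \<exists>q\<in>domC f. \<exists>v. p @- w = q @- v \<and> t = the (f q) @- v) = the (f p) @- w"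
    using assms(2) by (intro the_equality) blast+
  then show ?thesis using assms(2) unfolding omega_action_def by auto
qed

lemma right_ideal_morphism_append:
  "right_ideal_morphism f \<Longrightarrow> f x = Some y \<Longrightarrow> f (x @ w) = Some (y @ w)"
  by (auto simp: right_ideal_morphism_def dom_def)

lemma right_ideal_morphismI:
  assumes "\<And>x y w. f x = Some y \<Longrightarrow> f (x @ w) = Some (y @ w)"
  shows "right_ideal_morphism f"
  using assms by (auto simp: right_ideal_morphism_def intro!: right_idealI)

lemma right_ideal_morphism_comp:
  "right_ideal_morphism g \<Longrightarrow> right_ideal_morphism f \<Longrightarrow> right_ideal_morphism (g \<circ>\<^sub>m f)"
  by (rule right_ideal_morphismI)
    (auto simp: map_comp_Some_iff right_ideal_morphism_append)

lemma bd_equiv_single_valued: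
  assumes f: "right_ideal_morphism f"
    and g: "right_ideal_morphism g" "bd_equiv g f" "g x = Some y"
    and h: "right_ideal_morphism h" "bd_equiv h f" "h x = Some z"
  shows "y = z"
proof -
  have "right_span (domC g) \<inter> right_span {x} \<noteq> {}"
    using g(3) domC(2)[OF g(1)] right_spanI[of x "{x}"] by auto
  then have "right_span (domC f) \<inter> right_span {x} \<noteq> {}"
    using g(2) right_ideal_right_span by (auto simp: bd_equiv_def bd_equiv_code_def end_equiv_def)
  then obtain w where w: "x @ w \<in> dom f"
    using domC(2)[OF f] by (auto simp: right_span_def)
  have gw: "g (x @ w) = Some (y @ w)" and hw: "h (x @ w) = Some (z @ w)"
    using right_ideal_morphism_append g(1,3) h(1,3) by blast+
  have "g (x @ w) = f (x @ w)" "h (x @ w) = f (x @ w)"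
    using g(2) h(2) w gw hw unfolding bd_equiv_def by blast+
  then have "Some (y @ w) = Some (z @ w)" unfolding gw hw by (rule trans[OF _ sym])
  then show ?thesis by simp
qed

lemma bmax_eq_Some_iff:
  assumes "right_ideal_morphism f"
  shows "bmax f x = Some y \<longleftrightarrow> (\<exists>g. right_ideal_morphism g \<and> bd_equiv g f \<and> g x = Some y)"
proof -
  define G where "G = \<Union>{Map.graph g | g. right_ideal_morphism g \<and> bd_equiv g f}"
  have G: "(x, z) \<in> G \<longleftrightarrow> (\<exists>g. right_ideal_morphism g \<and> bd_equiv g f \<and> g x = Some z)" for z
    unfolding G_def by (auto simp: Map.graph_def)
  have unique: "y' = z'" if "(x, y') \<in> G" "(x, z') \<in> G" for y' z'
    using that bd_equiv_single_valued[OF assms] unfolding G by blast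
  have bmax: "bmax f x = (if \<exists>y. (x, y) \<in> G then Some (THE y. (x, y) \<in> G) else None)"
    unfolding bmax_def Let_def G_def by (rule refl)
  have "bmax f x = Some y \<longleftrightarrow> (x, y) \<in> G"
  proof (cases "\<exists>y. (x, y) \<in> G")
    case True
    then obtain y' where y': "(x, y') \<in> G" ..
    have "(THE y. (x, y) \<in> G) = y'" using y' unique by blast
    then have "bmax f x = Some y'" using True bmax by simp
    then show ?thesis using y' unique by auto
  next
    case False
    then show ?thesis using bmax by simp
  qed
  then show ?thesis using G by simp
qed

lemma graph_bmax:
  assumes "right_ideal_morphism f"
  shows "Map.graph (bmax f) = \<Union>{Map.graph g | g. right_ideal_morphism g \<and> bd_equiv g f}"
  by (auto simp: Map.graph_def bmax_eq_Some_iff[OF assms])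

lemma right_ideal_morphism_bmax:
  "right_ideal_morphism f \<Longrightarrow> right_ideal_morphism (bmax f)"
  by (rule right_ideal_morphismI)
    (auto simp: bmax_eq_Some_iff intro: right_ideal_morphism_append)

end

theory Submission
  imports Defs
begin

text \<open>
  Everything reduces to the action on \<open>\<omega>\<close>-sequences: \<^const>\<open>bd_equiv\<close> is the kernel of
  \<^const>\<open>omega_action\<close>, and \<^const>\<open>omega_action\<close> turns composition of morphisms into composition
  of partial functions.  The kernel of a homomorphism is a congruence, and it restricts to a
  congruence on every submonoid.  Since
  \<^term>\<open>bmax f\<close> is glued from morphisms in the class of \<^term>\<open>f\<close>, it acts as \<^term>\<open>f\<close> does, which
  gives the identities for \<^const>\<open>bmax\<close>.

  That \<^const>\<open>bd_equiv\<close> is the kernel rests on a statement about prefix codes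
  (\<open>bd_equiv_code_iff_omega_span\<close>): two codes are \<^const>\<open>bd_equiv_code\<close>-related iff they cover the
  same \<open>\<omega>\<close>-sequences.  If the same sequences are covered, then by compactness of the Cantor space
  (Koenig's lemma, \<open>finite_extensions_in_covering_code\<close>) only finitely many words of one code are
  comparable with a given word of the other, and there are finitely many words of each length;
  this yields the bound \<open>\<beta>\<close>.  Conversely, if a sequence starts with a code word \<open>p\<close> of \<open>P\<close> but
  with none of \<open>Q\<close>, then \<^const>\<open>end_equiv\<close> yields words of \<open>Q\<close> that extend arbitrarily
  long prefixes of the sequence; they extend \<open>p\<close>, against the bound \<open>\<beta> (length p)\<close>.
\<close>

section \<open>Sequences covered by a code\<close>

definition omega_span :: "word set \<Rightarrow> bool stream set" where
  "omega_span L = {x @- w | x w. x \<in> L}"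

lemma omega_spanI: "x \<in> L \<Longrightarrow> x @- w \<in> omega_span L"
  unfolding omega_span_def by blast

lemma omega_span_right_span: "omega_span (right_span L) = omega_span L"
proof
  show "omega_span (right_span L) \<subseteq> omega_span L"
    unfolding omega_span_def right_span_def by (force simp: shift_append)
  show "omega_span L \<subseteq> omega_span (right_span L)"
    using right_spanI unfolding omega_span_def by blast
qed

text \<open>Koenig's lemma.  Extending \<open>p\<close> again and again by a letter that keeps infinitely many
  extensions in \<open>Q\<close> produces a sequence, and a code word on this sequence would be a prefix of
  other code words.\<close>

lemma finite_extensions_in_covering_code:
  assumes Q: "prefix_code Q" and cover: "\<And>w. p @- w \<in> omega_span Q"
  shows "finite {q \<in> Q. prefix p q}"
proof (rule ccontr)
  assume inf: "infinite {q \<in> Q. prefix p q}"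
  have step: "\<exists>b. infinite {q \<in> Q. prefix (x @ [b]) q}" if "infinite {q \<in> Q. prefix x q}" for x
  proof (rule ccontr)
    assume "\<not> ?thesis"
    then have "finite (insert x (\<Union>b. {q \<in> Q. prefix (x @ [b]) q}))" by simp
    moreover have "{q \<in> Q. prefix x q} \<subseteq> insert x (\<Union>b. {q \<in> Q. prefix (x @ [b]) q})"
    proof
      fix q assume q: "q \<in> {q \<in> Q. prefix x q}"
      then obtain u where "q = x @ u" by (auto simp: prefix_def)
      then show "q \<in> insert x (\<Union>b. {q \<in> Q. prefix (x @ [b]) q})"
        using q by (cases u) auto
    qed
    ultimately show False using that finite_subset by blast
  qed
  then obtain b where b: "\<And>x. infinite {q \<in> Q. prefix x q} \<Longrightarrow>
      infinite {q \<in> Q. prefix (x @ [b x]) q}"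
    by metis
  define s where "s x = smap b (siterate (\<lambda>x. x @ [b x]) x)" for x
  have s: "s x = b x ## s (x @ [b x])" for x
    unfolding s_def by (subst siterate.code) simp
  have along: "infinite {q \<in> Q. prefix (x @ stake n (s x)) q}"
    if "infinite {q \<in> Q. prefix x q}" for n x
    using that
  proof (induction n arbitrary: x)
    case 0
    then show ?case by simp
  next
    case (Suc n)
    have "x @ stake (Suc n) (s x) = (x @ [b x]) @ stake n (s (x @ [b x]))"
      by (subst s) simp
    then show ?case using Suc.IH[OF b[OF Suc.prems]] by simp
  qed
  obtain q v where q: "q \<in> Q" "p @- s p = q @- v"
    using cover[of "s p"] unfolding omega_span_def by blast
  let ?x = "p @ stake (length q) (s p)"
  have "q @- v = ?x @- sdrop (length q) (s p)"
    unfolding q(2)[symmetric] shift_append by (simp add: stake_sdrop)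
  then have "prefix q ?x" by (rule shift_eq_prefix) simp
  then have "{q' \<in> Q. prefix ?x q'} \<subseteq> {q}"
    using Q q(1) prefix_order.trans unfolding prefix_code_def pref_comparable_def by blast
  then show False using along[OF inf] finite_subset by blast
qed

lemma finite_comparable_in_covering_code:
  assumes "prefix_code Q" "\<And>w. p @- w \<in> omega_span Q"
  shows "finite {q \<in> Q. pref_comparable p q}"
proof -
  have "{q. prefix q p} = set (prefixes p)" by auto
  then have "finite {q. prefix q p}" by (metis List.finite_set)
  then have "finite ({q \<in> Q. prefix p q} \<union> {q. prefix q p})"
    using finite_extensions_in_covering_code[OF assms] by simp
  then show ?thesis by (rule rev_finite_subset) (auto simp: pref_comparable_def)
qed

lemma length_bound_if_covering_code:
  assumes Q: "prefix_code Q" and cover: "omega_span P \<subseteq> omega_span Q"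
  shows "\<exists>\<beta> :: nat \<Rightarrow> nat. \<forall>p\<in>P. \<forall>q\<in>Q. pref_comparable p q \<longrightarrow> length q \<le> \<beta> (length p)"
proof -
  have "\<exists>m. \<forall>p\<in>P. \<forall>q\<in>Q. pref_comparable p q \<longrightarrow> length p = n \<longrightarrow> length q \<le> m" for n
  proof -
    let ?S = "\<Union>p \<in> {p \<in> P. length p = n}. {q \<in> Q. pref_comparable p q}"
    have "finite {p :: word. length p = n}"
      using finite_lists_length_eq[of "UNIV :: bool set" n] by simp
    then have "finite {p \<in> P. length p = n}" by (rule rev_finite_subset) auto
    moreover have "finite {q \<in> Q. pref_comparable p q}" if "p \<in> P" for p
      using that cover omega_spanI by (intro finite_comparable_in_covering_code[OF Q]) blast
    ultimately have "finite (length ` ?S)" by blast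
    then obtain m where "\<forall>k\<in>length ` ?S. k \<le> m"
      unfolding finite_nat_set_iff_bounded_le by blast
    then show ?thesis by blast
  qed
  then obtain \<beta> where "\<And>n. \<forall>p\<in>P. \<forall>q\<in>Q. pref_comparable p q \<longrightarrow> length p = n \<longrightarrow> length q \<le> \<beta> n"
    by metis
  then show ?thesis by blast
qed

text \<open>A point of \<open>right_span P \<inter> R\<close>, continued to a sequence, meets a code word of \<open>Q\<close>; the longer
  of the two words lies in both ideals.\<close>

lemma right_span_meets_if_covering:
  assumes cover: "omega_span P \<subseteq> omega_span Q" and R: "right_ideal R"
    and meet: "right_span P \<inter> R \<noteq> {}"
  shows "right_span Q \<inter> R \<noteq> {}"
proof -
  obtain x where x: "x \<in> right_span P" "x \<in> R" using meet by blast
  have "x @- sconst True \<in> omega_span Q"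
    using omega_spanI[OF x(1)] cover by (auto simp: omega_span_right_span)
  then obtain q v where q: "q \<in> Q" "x @- sconst True = q @- v"
    unfolding omega_span_def by blast
  from shift_eq_comparable[OF q(2)] consider u where "q = x @ u" | u where "x = q @ u"
    unfolding pref_comparable_def prefix_def by blast
  then show ?thesis
  proof cases
    case 1
    then show ?thesis using right_ideal_append[OF R x(2)] right_spanI[OF q(1)] by blast
  next
    case 2
    then show ?thesis using x(2) q(1) unfolding right_span_def by blast
  qed
qed

lemma pref_comparable_sym: "pref_comparable x y \<longleftrightarrow> pref_comparable y x"
  unfolding pref_comparable_def by blast

lemma bd_equiv_code_sym: "bd_equiv_code P Q \<Longrightarrow> bd_equiv_code Q P"
  unfolding bd_equiv_code_def end_equiv_def using pref_comparable_sym by metis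

text \<open>The bound \<open>\<beta>\<close> enters because, for \<^const>\<open>end_equiv\<close> alone, \<open>Q\<close> could meet every ideal along
  a sequence in ever longer words that all branch off the sequence.\<close>

lemma omega_span_mono_if_bd_equiv_code:
  assumes "bd_equiv_code P Q"
  shows "omega_span P \<subseteq> omega_span Q"
proof
  fix s assume "s \<in> omega_span P"
  then obtain p w where p: "p \<in> P" "s = p @- w" unfolding omega_span_def by blast
  obtain \<beta> :: "nat \<Rightarrow> nat" where
    \<beta>: "\<And>q. q \<in> Q \<Longrightarrow> pref_comparable p q \<Longrightarrow> length q \<le> \<beta> (length p)"
    using assms p(1) unfolding bd_equiv_code_def by blast
  \<comment> \<open>This prefix of \<open>s\<close> extends \<open>p\<close> and is too long to be a prefix of a word of \<open>Q\<close>
      comparable with \<open>p\<close>.\<close>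
  define x where "x = p @ stake (Suc (\<beta> (length p))) w"
  have "x \<in> right_span P" using p(1) unfolding x_def right_span_def by blast
  then have "right_span P \<inter> right_span {x} \<noteq> {}" using right_spanI[of x "{x}"] by blast
  then have "right_span Q \<inter> right_span {x} \<noteq> {}"
    using assms right_ideal_right_span unfolding bd_equiv_code_def end_equiv_def by blast
  then obtain q u v where q: "q \<in> Q" "x @ v = q @ u"
    unfolding right_span_def by auto
  have "prefix x q \<or> prefix q x"
    using q(2) by (metis prefixI prefix_same_cases)
  moreover have "\<not> prefix x q"
  proof
    assume xq: "prefix x q"
    have "prefix p x" unfolding x_def by simp
    then have "prefix p q" using xq prefix_order.trans by blast
    then have "length q \<le> \<beta> (length p)" using \<beta> q(1) by (simp add: pref_comparable_def)
    moreover have "length x \<le> length q" using xq by (rule prefix_length_le)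
    ultimately show False unfolding x_def by simp
  qed
  ultimately obtain z where z: "x = q @ z" unfolding prefix_def by blast
  have "s = x @- sdrop (Suc (\<beta> (length p))) w"
    unfolding x_def p(2) shift_append by (simp only: stake_sdrop)
  then have "s = q @- (z @- sdrop (Suc (\<beta> (length p))) w)"
    unfolding z by (simp only: shift_append)
  then show "s \<in> omega_span Q" using q(1) omega_spanI by metis
qed

lemma bd_equiv_code_iff_omega_span:
  assumes P: "prefix_code P" and Q: "prefix_code Q"
  shows "bd_equiv_code P Q \<longleftrightarrow> omega_span P = omega_span Q"
proof
  assume "bd_equiv_code P Q"
  then show "omega_span P = omega_span Q"
    using omega_span_mono_if_bd_equiv_code bd_equiv_code_sym by blast
next
  assume eq: "omega_span P = omega_span Q"
  have "end_equiv P Q"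
    unfolding end_equiv_def
    using right_span_meets_if_covering[of P Q] right_span_meets_if_covering[of Q P] eq by blast
  moreover obtain \<beta> \<gamma> :: "nat \<Rightarrow> nat"
    where \<beta>: "\<forall>p\<in>P. \<forall>q\<in>Q. pref_comparable p q \<longrightarrow> length q \<le> \<beta> (length p)"
      and \<gamma>: "\<forall>q\<in>Q. \<forall>p\<in>P. pref_comparable q p \<longrightarrow> length p \<le> \<gamma> (length q)"
    using length_bound_if_covering_code[OF Q] length_bound_if_covering_code[OF P] eq
    by (metis order_refl)
  then have "\<forall>p\<in>P. \<forall>q\<in>Q. pref_comparable p q \<longrightarrow>
      length p \<le> max (\<beta> (length q)) (\<gamma> (length q)) \<and>
      length q \<le> max (\<beta> (length p)) (\<gamma> (length p))"
    using pref_comparable_sym by (simp add: le_max_iff_disj)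
  then have "\<exists>\<delta> :: nat \<Rightarrow> nat. \<forall>p\<in>P. \<forall>q\<in>Q. pref_comparable p q \<longrightarrow>
      length p \<le> \<delta> (length q) \<and> length q \<le> \<delta> (length p)"
    by (rule exI[of _ "\<lambda>n. max (\<beta> n) (\<gamma> n)"])
  ultimately show "bd_equiv_code P Q" unfolding bd_equiv_code_def by blast
qed

section \<open>The action of a right-ideal morphism\<close>

text \<open>The action can be computed from any prefix in the domain, not only from the one in
  \<^const>\<open>domC\<close>; two morphisms, or a composition, can so be compared at a common long prefix of a
  sequence.\<close>

lemma omega_action_eq_Some_iff:
  assumes f: "right_ideal_morphism f"
  shows "omega_action f s = Some t \<longleftrightarrow> (\<exists>x y w. s = x @- w \<and> f x = Some y \<and> t = y @- w)"
proof
  assume st: "omega_action f s = Some t"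
  then obtain p w where p: "p \<in> domC f" "s = p @- w"
    unfolding omega_action_def by (auto split: if_splits)
  have "p \<in> dom f" using right_spanI[OF p(1)] domC(2)[OF f] by simp
  moreover have "t = the (f p) @- w" using omega_action_shift[OF f p(1), of w] st p(2) by simp
  ultimately show "\<exists>x y w. s = x @- w \<and> f x = Some y \<and> t = y @- w"
    unfolding p(2) by force
next
  assume "\<exists>x y w. s = x @- w \<and> f x = Some y \<and> t = y @- w"
  then obtain x y w where x: "s = x @- w" "f x = Some y" "t = y @- w" by blast
  then have "x \<in> right_span (domC f)" using domC(2)[OF f] by auto
  then obtain p u where p: "p \<in> domC f" "x = p @ u" unfolding right_span_def by blast
  obtain z where z: "f p = Some z" using right_spanI[OF p(1)] domC(2)[OF f] by auto
  have "f x = Some (z @ u)" using right_ideal_morphism_append[OF f z] p(2) by simp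
  then have "t = z @- (u @- w)" using x(2,3) by (simp add: shift_append)
  moreover have "s = p @- (u @- w)" using x(1) p(2) by (simp add: shift_append)
  ultimately show "omega_action f s = Some t"
    using omega_action_shift[OF f p(1), of "u @- w"] z by simp
qed

lemma dom_omega_action:
  assumes "right_ideal_morphism f"
  shows "dom (omega_action f) = omega_span (dom f)"
  by (auto simp: set_eq_iff dom_def omega_span_def omega_action_eq_Some_iff[OF assms])

lemma map_eqI: "(\<And>x y. f x = Some y \<longleftrightarrow> g x = Some y) \<Longrightarrow> f = g"
  by (rule ext) (metis not_Some_eq)

lemma shift_eq_shift_all:
  fixes y z :: word
  assumes "\<And>w. y @- w = z @- w"
  shows "y = z"
proof -
  have longer: "a = b" if eq: "\<And>w :: bool stream. a @- w = b @- w" and le: "length a \<le> length b" for a b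
  proof -
    obtain c where c: "b = a @ c" using shift_eq_prefix[OF eq le] by (auto simp: prefix_def)
    have w: "w = c @- w" for w :: "bool stream"
      using eq[of w] unfolding c by (simp add: shift_append)
    have "c = []"
    proof (cases c)
      case (Cons d c')
      \<comment> \<open>A sequence that starts with the wrong letter.\<close>
      then show ?thesis using arg_cong[OF w[of "sconst (\<not> d)"], of shd] by simp
    qed
    then show ?thesis using c by simp
  qed
  show ?thesis
    using longer[of y z] longer[of z y] assms by (metis nat_le_linear)
qed

lemma omega_action_eq_iff_agree:
  assumes f: "right_ideal_morphism f" and g: "right_ideal_morphism g"
  shows "omega_action f = omega_action g \<longleftrightarrow>
    omega_span (dom f) = omega_span (dom g) \<and> (\<forall>x\<in>dom f \<inter> dom g. f x = g x)"
    (is "?L \<longleftrightarrow> ?S \<and> ?A")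
proof
  assume eq: ?L
  have ?S using dom_omega_action[OF f] dom_omega_action[OF g] eq by simp
  moreover have ?A
  proof
    fix x assume "x \<in> dom f \<inter> dom g"
    then obtain y z where yz: "f x = Some y" "g x = Some z" by blast
    have "y @- w = z @- w" for w
    proof -
      have "omega_action f (x @- w) = Some (y @- w)" "omega_action g (x @- w) = Some (z @- w)"
        unfolding omega_action_eq_Some_iff[OF f] omega_action_eq_Some_iff[OF g] using yz by blast+
      then show ?thesis using eq by simp
    qed
    then show "f x = g x" using shift_eq_shift_all yz by metis
  qed
  ultimately show "?S \<and> ?A" by blast
next
  have sub: "omega_action k s = Some t"
    if h: "right_ideal_morphism h" and k: "right_ideal_morphism k"
      and S: "omega_span (dom h) \<subseteq> omega_span (dom k)" and A: "\<forall>x\<in>dom h \<inter> dom k. h x = k x"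
      and st: "omega_action h s = Some t" for h k s t
  proof -
    obtain x y w where x: "s = x @- w" "h x = Some y" "t = y @- w"
      using st omega_action_eq_Some_iff[OF h] by blast
    then have "s \<in> omega_span (dom k)" using S omega_spanI[of x "dom h" w] by blast
    then obtain x' z w' where x': "s = x' @- w'" "k x' = Some z"
      unfolding omega_span_def by blast
    \<comment> \<open>The longer of the prefixes \<open>x\<close>, \<open>x'\<close> of \<open>s\<close> lies in both domains.\<close>
    from shift_eq_comparable[of x w x' w'] x(1) x'(1)
    consider u where "x' = x @ u" | u where "x = x' @ u"
      unfolding pref_comparable_def prefix_def by blast
    then show ?thesis
    proof cases
      case 1
      then have "h x' = Some (y @ u)" using right_ideal_morphism_append[OF h x(2)] by simp
      moreover from this have "h x' = k x'" using A x'(2) by blast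
      moreover have "w = u @- w'" using x(1) x'(1) 1 by (simp add: shift_append)
      ultimately have "k x' = Some (y @ u) \<and> t = (y @ u) @- w'"
        using x(3) by (simp add: shift_append)
      then show ?thesis unfolding omega_action_eq_Some_iff[OF k] using x'(1) by blast
    next
      case 2
      then have "k x = Some (z @ u)" using right_ideal_morphism_append[OF k x'(2)] by simp
      then have "k x = Some y" using A x(2) by (metis IntI domI)
      then show ?thesis unfolding omega_action_eq_Some_iff[OF k] using x by blast
    qed
  qed
  assume SA: "?S \<and> ?A"
  then have "?S" "\<forall>x\<in>dom g \<inter> dom f. g x = f x" by auto
  then show ?L using sub[OF f g] sub[OF g f] SA by (intro map_eqI) blast
qed

lemma omega_action_eq_iff_bd_equiv:
  assumes f: "right_ideal_morphism f" and g: "right_ideal_morphism g"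
  shows "omega_action f = omega_action g \<longleftrightarrow> bd_equiv f g"
proof -
  have "omega_span (domC f) = omega_span (dom f)" "omega_span (domC g) = omega_span (dom g)"
    using omega_span_right_span[of "domC f"] omega_span_right_span[of "domC g"]
      domC(2)[OF f] domC(2)[OF g] by simp_all
  then show ?thesis
    unfolding omega_action_eq_iff_agree[OF f g] bd_equiv_def
      bd_equiv_code_iff_omega_span[OF domC(1)[OF f] domC(1)[OF g]]
    by simp
qed

text \<open>A sequence may be in the domain of the right-hand side although its chosen prefix \<open>x\<close> in the
  domain of \<open>f\<close> has \<open>f x\<close> outside the domain of \<open>g\<close>; a longer prefix of the sequence then maps
  into the domain of \<open>g\<close>.\<close>

lemma omega_action_comp:
  assumes f: "right_ideal_morphism f" and g: "right_ideal_morphism g"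
  shows "omega_action (g \<circ>\<^sub>m f) = omega_action g \<circ>\<^sub>m omega_action f"
proof (rule map_eqI)
  fix s t
  note gf = omega_action_eq_Some_iff[OF right_ideal_morphism_comp[OF g f]]
  show "omega_action (g \<circ>\<^sub>m f) s = Some t \<longleftrightarrow> (omega_action g \<circ>\<^sub>m omega_action f) s = Some t"
  proof
    assume "omega_action (g \<circ>\<^sub>m f) s = Some t"
    then obtain x y z w where "s = x @- w" "f x = Some y" "g y = Some z" "t = z @- w"
      unfolding gf map_comp_Some_iff by blast
    then show "(omega_action g \<circ>\<^sub>m omega_action f) s = Some t"
      unfolding map_comp_Some_iff omega_action_eq_Some_iff[OF f] omega_action_eq_Some_iff[OF g]
      by blast
  next
    assume "(omega_action g \<circ>\<^sub>m omega_action f) s = Some t"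
    then obtain x y w y' z v where x: "s = x @- w" "f x = Some y"
      and y': "y @- w = y' @- v" "g y' = Some z" "t = z @- v"
      unfolding map_comp_Some_iff omega_action_eq_Some_iff[OF f] omega_action_eq_Some_iff[OF g]
      by blast
    define n where "n = length y'"
    have w: "w = stake n w @- sdrop n w" by (simp add: stake_sdrop)
    have eq: "y' @- v = (y @ stake n w) @- sdrop n w"
      using y'(1) w by (simp only: shift_append)
    then have "prefix y' (y @ stake n w)" by (rule shift_eq_prefix) (simp add: n_def)
    then obtain u where u: "y @ stake n w = y' @ u" by (auto simp: prefix_def)
    have "f (x @ stake n w) = Some (y' @ u)"
      using right_ideal_morphism_append[OF f x(2)] u by simp
    moreover have "g (y' @ u) = Some (z @ u)" by (rule right_ideal_morphism_append[OF g y'(2)])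
    moreover have "s = (x @ stake n w) @- sdrop n w" using x(1) w by (simp only: shift_append)
    moreover have "v = u @- sdrop n w" using eq unfolding u by (simp add: shift_append)
    then have "t = (z @ u) @- sdrop n w" using y'(3) by (simp add: shift_append)
    ultimately show "omega_action (g \<circ>\<^sub>m f) s = Some t"
      unfolding gf map_comp_Some_iff by blast
  qed
qed

lemma omega_action_bmax:
  assumes f: "right_ideal_morphism f"
  shows "omega_action (bmax f) = omega_action f"
proof (rule map_eqI)
  fix s t
  have self: "bd_equiv f f" using omega_action_eq_iff_bd_equiv[OF f f] by simp
  have "omega_action (bmax f) s = Some t \<longleftrightarrow>
      (\<exists>g. right_ideal_morphism g \<and> bd_equiv g f \<and> omega_action g s = Some t)"
    unfolding omega_action_eq_Some_iff[OF right_ideal_morphism_bmax[OF f]]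
      bmax_eq_Some_iff[OF f]
    using omega_action_eq_Some_iff by blast
  also have "\<dots> \<longleftrightarrow> omega_action f s = Some t"
    using f self omega_action_eq_iff_bd_equiv by metis
  finally show "omega_action (bmax f) s = Some t \<longleftrightarrow> omega_action f s = Some t" .
qed

section \<open>The congruence\<close>

text \<open>\<^const>\<open>omega_action\<close> is a homomorphism into the partial functions on sequences, and
  \<^const>\<open>bd_equiv\<close> is its kernel.\<close>

lemma congruence_on_bd_equiv:
  assumes M: "M \<subseteq> RM"
  shows "congruence_on M (\<circ>\<^sub>m) bd_equiv"
proof -
  have rim: "right_ideal_morphism f" if "f \<in> M" for f using that M unfolding RM_def by blast
  have ker: "bd_equiv f g \<longleftrightarrow> omega_action f = omega_action g" if "f \<in> M" "g \<in> M" for f g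
    using omega_action_eq_iff_bd_equiv rim that by blast
  have "{(f, g). f \<in> M \<and> g \<in> M \<and> bd_equiv f g} =
      {(f, g). f \<in> M \<and> g \<in> M \<and> omega_action f = omega_action g}"
    using ker by blast
  moreover have "equiv M {(f, g). f \<in> M \<and> g \<in> M \<and> omega_action f = omega_action g}"
    by (rule equivI) (auto simp: refl_on_def sym_def trans_def)
  moreover have "bd_equiv (a \<circ>\<^sub>m c) (b \<circ>\<^sub>m d)"
    if "a \<in> M" "b \<in> M" "c \<in> M" "d \<in> M" "bd_equiv a b" "bd_equiv c d" for a b c d
  proof -
    have "omega_action (a \<circ>\<^sub>m c) = omega_action (b \<circ>\<^sub>m d)"
      using that ker rim by (simp add: omega_action_comp)
    then show ?thesis
      using that rim by (simp add: omega_action_eq_iff_bd_equiv right_ideal_morphism_comp)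
  qed
  ultimately show ?thesis unfolding congruence_on_def by auto
qed

theorem corollary3p8:
  shows "(\<forall>f g. right_ideal_morphism f \<and> right_ideal_morphism g \<longrightarrow>
            (omega_action f = omega_action g \<longleftrightarrow> bd_equiv g f))
       \<and> (\<forall>f g. right_ideal_morphism f \<and> right_ideal_morphism g \<longrightarrow>
            omega_action (bmax g \<circ>\<^sub>m bmax f) = omega_action (bmax (g \<circ>\<^sub>m f)) \<and>
            omega_action (bmax g) \<circ>\<^sub>m omega_action (bmax f) = omega_action (bmax (g \<circ>\<^sub>m f)))
       \<and> congruence_on RM (\<circ>\<^sub>m) bd_equiv
       \<and> congruence_on RMP (\<circ>\<^sub>m) bd_equiv"
proof (intro conjI allI impI; (elim conjE)?)
  fix f g assume f: "right_ideal_morphism f" and g: "right_ideal_morphism g"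
  show "omega_action f = omega_action g \<longleftrightarrow> bd_equiv g f"
    using omega_action_eq_iff_bd_equiv[OF g f] by auto
  show "omega_action (bmax g) \<circ>\<^sub>m omega_action (bmax f) = omega_action (bmax (g \<circ>\<^sub>m f))"
    using f g by (simp add: omega_action_bmax omega_action_comp right_ideal_morphism_comp)
  then show "omega_action (bmax g \<circ>\<^sub>m bmax f) = omega_action (bmax (g \<circ>\<^sub>m f))"
    using f g by (simp add: omega_action_comp right_ideal_morphism_bmax)
next
  show "congruence_on RM (\<circ>\<^sub>m) bd_equiv" by (rule congruence_on_bd_equiv) simp
  show "congruence_on RMP (\<circ>\<^sub>m) bd_equiv"
    by (rule congruence_on_bd_equiv) (auto simp: RM_def RMP_def)
qed

end
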